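(* Let $d\ge3$, and fix $u_1>0$ and constants $c_0=c_0(d)>0$, $C_0=C_0(d)<\infty$ such that for all $0\le u\le u_1$ and $n\ge1$ both $$\mathbb P\left[\text{the infinite connected component of } \mathcal V^u \text{ intersects } \mathrm B(0,n)\right]\geq 1-C_0e^{-n^{c_0}}$$ and $$\mathbb P\left[\begin{array}{c}\text{any two connected subsets of } \mathcal V^u\cap \mathrm B(0,n) \text{ with diameter} \geq n/10\\ \text{are connected in } \mathcal V^u\cap \mathrm B(0,2n)\end{array}\right]\geq 1-C_0e^{-n^{c_0}}$$ (such $u_1,c_0,C_0$ exist). Then there exist $c=c(d)>0$ and $C=C(d)<\infty$ such that for all $0\le u\leq u_1$ and all $n\ge1$, $$\mathbb P\left[n\leq \mathrm{diam}(\mathcal C^u(0))<\infty\right]\leq Ce^{-n^c}\qquad\text{and}\qquad \mathbb P\left[n\leq|\mathcal C^u(0)|<\infty\right]\leq Ce^{-n^c},$$ where $\mathrm{diam}(\mathcal C^u(0))$ and $|\mathcal C^u(0)|$ denote the diameter and the cardinality of the connected component $\mathcal C^u(0)$ of the origin in $\mathcal V^u$, respectively.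
   Context: Let $d\ge 3$. For $x\in\mathbb Z^d$, $|x|$ is the sup-norm and $|x|_1$ the $L_1$-norm; $\mathrm B(x,R)=\{y\in\mathbb Z^d:|x-y|\le R\}$. For $x\in\mathbb Z^d$ let $P_x$ be the law of simple random walk $(X(t))_{t\ge0}$ on $\mathbb Z^d$ started at $x$. For finite $K\subset\mathbb Z^d$ let $\widetilde H_K=\inf\{n\ge1:X(n)\in K\}$ and let the capacity of $K$ be $\mathrm{cap}(K)=\sum_{x\in K}P_x[\widetilde H_K=\infty]$. Random interlacements at level $u\geq 0$ is the random subset $\mathcal I^u$ of $\mathbb Z^d$ whose law is characterized by $\mathbb P[\mathcal I^u\cap K=\emptyset]=e^{-u\,\mathrm{cap}(K)}$ for all finite $K\subseteq\mathbb Z^d$. The vacant set at level $u$ is $\mathcal V^u=\mathbb Z^d\setminus\mathcal I^u$, viewed as a graph with an edge between any two of its vertices at $L_1$-distance $1$; connectedness and connected components refer to this nearest-neighbor structure. It is known that $\mathcal V^u$ almost surely has at most one infinite connected component; the first event in the claim is that this component exists and intersects $\mathrm B(0,n)$. Diameters are taken with respect to the sup-norm. Two connected subsets of $\mathcal V^u\cap\mathrm B(0,n)$ are connected in $\mathcal V^u\cap\mathrm B(0,2n)$ if some nearest-neighbor path with all vertices in $\mathcal V^u\cap\mathrm B(0,2n)$ joins a vertex of one to a vertex of the other. If $0\notin\mathcal V^u$, then $\mathcal C^u(0)=\emptyset$. The quantities $u_1,c_0,C_0$ are regarded as fixed once $d$ is fixed. *)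

theory Defs
  imports "HOL-Probability.Probability"
begin

definition sup_norm :: "int ^ 'd \<Rightarrow> int" where
  "sup_norm x = (MAX i. \<bar>x $ i\<bar>)"

definition l1_norm :: "int ^ 'd \<Rightarrow> int" where
  "l1_norm x = (\<Sum>i\<in>UNIV. \<bar>x $ i\<bar>)"

definition sup_ball :: "int ^ 'd \<Rightarrow> nat \<Rightarrow> (int ^ 'd) set" where
  "sup_ball x R = {y. sup_norm (x - y) \<le> int R}"

text \<open>
  With values in \<^typ>\<open>ennreal\<close> the diameter of an unbounded set is \<open>\<infinity>\<close> and that of the
  empty set is \<open>0\<close>.
\<close>

definition sup_diam :: "(int ^ 'd) set \<Rightarrow> ennreal" where
  "sup_diam A = (SUP x\<in>A. SUP y\<in>A. ennreal (real_of_int (sup_norm (x - y))))"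

definition adjacent :: "int ^ 'd \<Rightarrow> int ^ 'd \<Rightarrow> bool" where
  "adjacent x y \<longleftrightarrow> l1_norm (x - y) = 1"

definition joined_in :: "(int ^ 'd) set \<Rightarrow> int ^ 'd \<Rightarrow> int ^ 'd \<Rightarrow> bool" where
  "joined_in A x y \<longleftrightarrow>
     (\<exists>p. p \<noteq> [] \<and> hd p = x \<and> last p = y \<and> set p \<subseteq> A \<and> successively adjacent p)"

definition nn_connected :: "(int ^ 'd) set \<Rightarrow> bool" where
  "nn_connected S \<longleftrightarrow> (\<forall>x\<in>S. \<forall>y\<in>S. joined_in S x y)"

text \<open>This is empty if \<open>x \<notin> A\<close>, because a path in \<open>A\<close> must start in \<open>A\<close>.\<close>

definition cluster :: "(int ^ 'd) set \<Rightarrow> int ^ 'd \<Rightarrow> (int ^ 'd) set" where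
  "cluster A x = {y. joined_in A x y}"

definition clusters :: "(int ^ 'd) set \<Rightarrow> (int ^ 'd) set set" where
  "clusters A = cluster A ` A"

definition srw_step :: "(int ^ 'd) pmf" where
  "srw_step = pmf_of_set {e. l1_norm e = 1}"

definition srw :: "int ^ 'd \<Rightarrow> (nat \<Rightarrow> int ^ 'd) measure" where
  "srw x = distr (\<Pi>\<^sub>M k\<in>UNIV. measure_pmf srw_step) (\<Pi>\<^sub>M k\<in>UNIV. count_space UNIV)
             (\<lambda>\<xi> n. x + (\<Sum>k<n. \<xi> k))"

definition hitting_time :: "(int ^ 'd) set \<Rightarrow> (nat \<Rightarrow> int ^ 'd) \<Rightarrow> enat" where
  "hitting_time K X = Inf (enat ` {n. 1 \<le> n \<and> X n \<in> K})"

definition capacity :: "(int ^ 'd) set \<Rightarrow> real" where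
  "capacity K = (\<Sum>x\<in>K. measure (srw x) {X. hitting_time K X = \<infinity>})"

lemma finite_unit_vectors: "finite {e :: int ^ 'd. l1_norm e = 1}"
proof -
  let ?V = "{e :: int ^ 'd. \<forall>i. e $ i \<in> {-1..1}}"
  have "finite {f :: 'd \<Rightarrow> int. \<forall>i. f i \<in> {-1..1}}"
    using finite_PiE[of "UNIV :: 'd set" "\<lambda>_. {-1..1::int}"] by (simp add: PiE_def Pi_def)
  moreover have "?V \<subseteq> vec_lambda ` {f :: 'd \<Rightarrow> int. \<forall>i. f i \<in> {-1..1}}"
  proof
    fix e assume "e \<in> ?V"
    then show "e \<in> vec_lambda ` {f :: 'd \<Rightarrow> int. \<forall>i. f i \<in> {-1..1}}"
      by (intro image_eqI[of _ _ "vec_nth e"]) auto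
  qed
  ultimately have "finite ?V"
    by (meson finite_imageI finite_subset)
  moreover have "{e :: int ^ 'd. l1_norm e = 1} \<subseteq> ?V"
  proof
    fix e :: "int ^ 'd" assume "e \<in> {e. l1_norm e = 1}"
    then have "\<bar>e $ i\<bar> \<le> 1" for i
      using member_le_sum[of i UNIV "\<lambda>i. \<bar>e $ i\<bar>"] by (simp add: l1_norm_def)
    then show "e \<in> ?V"
      by (simp add: abs_le_iff minus_le_iff)
  qed
  ultimately show ?thesis
    by (rule rev_finite_subset)
qed

lemma unit_vectors_nonempty: "{e :: int ^ 'd. l1_norm e = 1} \<noteq> {}"
proof -
  have "l1_norm (axis i 1 :: int ^ 'd) = 1" for i :: 'd
    by (simp add: l1_norm_def axis_def if_distrib[of abs] cong: if_cong)
  then show ?thesis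
    by blast
qed

lemma set_pmf_srw_step: "set_pmf srw_step = {e :: int ^ 'd. l1_norm e = 1}"
  unfolding srw_step_def by (rule set_pmf_of_set[OF unit_vectors_nonempty finite_unit_vectors])

lemma measurable_srw_path:
  "(\<lambda>\<xi> n. x + (\<Sum>k<n. \<xi> k)) \<in>
     (\<Pi>\<^sub>M k\<in>UNIV. measure_pmf (srw_step :: (int ^ 'd) pmf))
       \<rightarrow>\<^sub>M (\<Pi>\<^sub>M k\<in>(UNIV :: nat set). count_space UNIV)"
proof (rule measurable_PiM_single')
  let ?M = "\<Pi>\<^sub>M k\<in>(UNIV :: nat set). measure_pmf (srw_step :: (int ^ 'd) pmf)"
  fix n :: nat
  show "(\<lambda>\<xi>. x + (\<Sum>k<n. \<xi> k)) \<in> ?M \<rightarrow>\<^sub>M count_space UNIV"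
  proof (induction n)
    case (Suc n)
    have comp: "(\<lambda>\<xi>. \<xi> n) \<in> ?M \<rightarrow>\<^sub>M count_space UNIV"
      using measurable_component_singleton[of n UNIV "\<lambda>_. measure_pmf srw_step"]
      by simp
    have "(\<lambda>\<xi>. (\<lambda>(a, b). a + b) (x + (\<Sum>k<n. \<xi> k), \<xi> n)) \<in> ?M \<rightarrow>\<^sub>M count_space UNIV"
      by (rule measurable_compose[OF measurable_Pair[OF Suc comp]])
         (simp add: pair_measure_countable)
    then show ?case
      by (simp add: add.assoc)
  qed simp
qed simp

lemma prob_space_srw: "prob_space (srw x)"
  unfolding srw_def
  by (intro prob_space.prob_space_distr measurable_srw_path prob_space_PiM
      prob_space_measure_pmf)

text \<open>
  Random interlacements at level \<open>u\<close> enter through their law, a probability measure on the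
  subsets of the lattice with the \<open>\<sigma>\<close>-algebra generated by the events \<open>x \<in> I\<close>.
\<close>

definition config_space :: "(int ^ 'd) set measure" where
  "config_space = sigma UNIV (range (\<lambda>x. {I. x \<in> I}))"

definition random_interlacements_law :: "real \<Rightarrow> (int ^ 'd) set measure \<Rightarrow> bool" where
  "random_interlacements_law u Q \<longleftrightarrow>
     prob_space Q \<and> sets Q = sets config_space \<and>
     (\<forall>K. finite K \<longrightarrow> measure Q {I. I \<inter> K = {}} = exp (- u * capacity K))"

definition vacant_set :: "(int ^ 'd) set \<Rightarrow> (int ^ 'd) set" where
  "vacant_set I = - I"

text \<open>
  Almost surely there is at most one infinite cluster, so that ``some infinite cluster'' is
  ``the infinite cluster''.
\<close>

definition infinite_cluster_meets_ball :: "nat \<Rightarrow> (int ^ 'd) set \<Rightarrow> bool" where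
  "infinite_cluster_meets_ball n V \<longleftrightarrow>
     (\<exists>C\<in>clusters V. infinite C \<and> C \<inter> sup_ball 0 n \<noteq> {})"

definition large_sets_connected :: "nat \<Rightarrow> (int ^ 'd) set \<Rightarrow> bool" where
  "large_sets_connected n V \<longleftrightarrow>
     (\<forall>S T. S \<subseteq> V \<inter> sup_ball 0 n \<and> nn_connected S \<and> sup_diam S \<ge> ennreal (real n / 10) \<and>
            T \<subseteq> V \<inter> sup_ball 0 n \<and> nn_connected T \<and> sup_diam T \<ge> ennreal (real n / 10) \<longrightarrow>
        (\<exists>x\<in>S. \<exists>y\<in>T. joined_in (V \<inter> sup_ball 0 (2 * n)) x y))"

end

theory Submission
  imports Defs
begin

text \<open>
  Let \<open>m = 2k\<close>. If the cluster of \<open>0\<close> reaches sup-distance \<open>m\<close>, it contains a connected subset of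
  \<open>B(0,m)\<close> of diameter at least \<open>m\<close>; an infinite cluster meeting \<open>B(0,k)\<close> must leave \<open>B(0,m)\<close> and
  so contains a connected subset of \<open>B(0,m)\<close> of diameter at least \<open>k\<close>. If large sets are connected at
  scale \<open>m\<close>, the two clusters coincide, so a finite cluster of \<open>0\<close> reaching distance \<open>m\<close> forces one
  of the two hypothesised events to fail. A set of diameter or cardinality at least \<open>n\<close> reaches
  distance \<open>m\<close> as soon as \<open>(4k)\<^sup>d \<le> n\<close>, and choosing the largest such \<open>k\<close> only costs a change of
  the exponent from \<open>c\<^sub>0\<close> to \<open>c\<^sub>0 / (2d)\<close>.
\<close>

section \<open>Sup-norm and balls\<close>

lemma sup_norm_le_iff: "sup_norm x \<le> r \<longleftrightarrow> (\<forall>i. \<bar>x $ i\<bar> \<le> r)"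
  unfolding sup_norm_def by (subst Max_le_iff) auto

lemma abs_component_le_sup_norm: "\<bar>x $ i\<bar> \<le> sup_norm x"
  using sup_norm_le_iff by blast

lemma sup_norm_nonneg: "0 \<le> sup_norm x"
  using abs_component_le_sup_norm[of x undefined] by linarith

lemma sup_norm_zero [simp]: "sup_norm 0 = 0"
  by (rule order_antisym[OF _ sup_norm_nonneg]) (simp add: sup_norm_le_iff)

lemma sup_norm_minus [simp]: "sup_norm (- x) = sup_norm x"
  by (simp add: sup_norm_def)

lemma sup_norm_triangle: "sup_norm (x + y) \<le> sup_norm x + sup_norm y"
  unfolding sup_norm_le_iff
proof
  fix i
  show "\<bar>(x + y) $ i\<bar> \<le> sup_norm x + sup_norm y"
    using abs_component_le_sup_norm[of x i] abs_component_le_sup_norm[of y i] by simp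
qed

lemma sup_norm_diff_le: "sup_norm (x - y) \<le> sup_norm x + sup_norm y"
  using sup_norm_triangle[of x "- y"] by simp

lemma sup_norm_le_l1_norm: "sup_norm x \<le> l1_norm x"
  unfolding sup_norm_le_iff l1_norm_def
  by (intro allI member_le_sum) auto

lemma l1_norm_minus [simp]: "l1_norm (- x) = l1_norm x"
  by (simp add: l1_norm_def)

lemma adjacent_sym: "adjacent x y \<Longrightarrow> adjacent y x"
  using l1_norm_minus[of "x - y"] by (simp add: adjacent_def)

lemma sup_norm_adjacent: "adjacent x y \<Longrightarrow> sup_norm y \<le> sup_norm x + 1"
  using sup_norm_diff_le[of x "x - y"] sup_norm_le_l1_norm[of "x - y"]
  by (simp add: adjacent_def)

lemma mem_sup_ball_zero [simp]: "x \<in> sup_ball 0 R \<longleftrightarrow> sup_norm x \<le> int R"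
  by (simp add: sup_ball_def)

text \<open>A point is determined by its coordinates, each of which has \<open>2 * R + 1\<close>
  possible values.\<close>

lemma finite_card_sup_ball:
  shows finite_sup_ball: "finite (sup_ball (0 :: int ^ 'd) R)"
    and card_sup_ball_le: "card (sup_ball (0 :: int ^ 'd) R) \<le> (2 * R + 1) ^ CARD('d)"
proof -
  let ?F = "(UNIV :: 'd set) \<rightarrow>\<^sub>E {- int R..int R}"
  have sub: "sup_ball 0 R \<subseteq> vec_lambda ` ?F"
  proof
    fix x :: "int ^ 'd" assume "x \<in> sup_ball 0 R"
    then have "\<bar>x $ i\<bar> \<le> int R" for i
      by (simp add: sup_norm_le_iff)
    then have "vec_nth x \<in> ?F"
      by (simp add: PiE_def Pi_def abs_le_iff minus_le_iff)
    then show "x \<in> vec_lambda ` ?F"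
      by (intro image_eqI[of _ _ "vec_nth x"]) auto
  qed
  have fin: "finite ?F"
    by (intro finite_PiE) auto
  with sub show "finite (sup_ball (0 :: int ^ 'd) R)"
    by (meson finite_imageI finite_subset)
  have "card (sup_ball (0 :: int ^ 'd) R) \<le> card ?F"
    using card_mono[OF finite_imageI[OF fin] sub] card_image_le[OF fin, of vec_lambda] by linarith
  also have "\<dots> = (2 * R + 1) ^ CARD('d)"
    by (simp add: card_PiE nat_add_distrib nat_mult_distrib add.commute)
  finally show "card (sup_ball (0 :: int ^ 'd) R) \<le> (2 * R + 1) ^ CARD('d)" .
qed

lemma sup_norm_diff_le_sup_diam:
  "x \<in> A \<Longrightarrow> y \<in> A \<Longrightarrow> ennreal (real_of_int (sup_norm (x - y))) \<le> sup_diam A"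
  unfolding sup_diam_def by (meson SUP_upper2 order_refl)

text \<open>All points lie within a bounded distance of one chosen point, hence in a ball, and
  lattice balls are finite. This turns the condition on the diameter into the finiteness used by the
  cluster argument.\<close>

lemma finite_of_sup_diam_finite:
  fixes A :: "(int ^ 'd) set"
  assumes "sup_diam A < \<infinity>"
  shows "finite A"
proof (cases "A = {}")
  case False
  then obtain a where a: "a \<in> A" by blast
  from assms obtain r where r: "0 \<le> r" "sup_diam A = ennreal r"
    by (cases "sup_diam A") auto
  have "x \<in> sup_ball 0 (nat (\<lceil>r\<rceil> + sup_norm a))" if "x \<in> A" for x
  proof -
    have "ennreal (real_of_int (sup_norm (x - a))) \<le> ennreal r"
      using sup_norm_diff_le_sup_diam[OF that a] r by simp
    then have "real_of_int (sup_norm (x - a)) \<le> r"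
      using r by (simp add: ennreal_le_iff)
    then have "sup_norm (x - a) \<le> \<lceil>r\<rceil>"
      by linarith
    then show ?thesis
      using sup_norm_triangle[of "x - a" a] by simp
  qed
  then show ?thesis
    using finite_subset[OF _ finite_sup_ball] by blast
qed simp

lemma sup_diam_le_twice:
  assumes "\<And>x. x \<in> A \<Longrightarrow> sup_norm x \<le> r"
  shows "sup_diam A \<le> ennreal (real_of_int (2 * r))"
proof -
  have "sup_norm (x - y) \<le> 2 * r" if "x \<in> A" "y \<in> A" for x y
    using sup_norm_diff_le[of x y] assms[OF that(1)] assms[OF that(2)] by linarith
  then show ?thesis
    unfolding sup_diam_def by (intro SUP_least ennreal_leI of_int_le_iff[THEN iffD2])
qed

text \<open>Norms are integers, so otherwise all are at most \<open>2 * k - 1\<close> and the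
  diameter is at most \<open>4 * k - 2 < n\<close>.\<close>

lemma far_point_of_sup_diam:
  assumes "of_nat n \<le> sup_diam A" "4 * k \<le> n" "1 \<le> k"
  shows "\<exists>x\<in>A. 2 * int k \<le> sup_norm x"
proof (rule ccontr)
  assume "\<not> ?thesis"
  then have "sup_norm x \<le> 2 * int k - 1" if "x \<in> A" for x
    using that by force
  from order_trans[OF assms(1) sup_diam_le_twice[OF this]]
  have "ennreal (real n) \<le> ennreal (real_of_int (2 * (2 * int k - 1)))"
    by (simp add: ennreal_of_nat_eq_real_of_nat)
  with assms(2,3) show False
    by (simp add: ennreal_le_iff)
qed

text \<open>The ball of radius \<open>2 * k - 1\<close> has at most \<open>(4 * k - 1) ^ d\<close>
  points, \<open>d\<close> being the dimension; this is the source of the threshold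
  \<open>(4 * k) ^ d\<close>.\<close>

lemma far_point_of_card:
  fixes A :: "(int ^ 'd) set"
  assumes "n \<le> card A" "(4 * k) ^ CARD('d) \<le> n" "1 \<le> k"
  shows "\<exists>x\<in>A. 2 * int k \<le> sup_norm x"
proof (rule ccontr)
  assume "\<not> ?thesis"
  then have "A \<subseteq> sup_ball 0 (2 * k - 1)"
    using assms(3) by (force simp: of_nat_diff)
  then have "card A \<le> (2 * (2 * k - 1) + 1) ^ CARD('d)"
    using card_mono[OF finite_sup_ball] card_sup_ball_le order_trans by blast
  also have "\<dots> < (4 * k) ^ CARD('d)"
    using assms(3) by (intro power_strict_mono) auto
  finally show False
    using assms by linarith
qed

section \<open>Paths and clusters\<close>

lemma joined_in_refl: "x \<in> A \<Longrightarrow> joined_in A x x"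
  unfolding joined_in_def by (rule exI[of _ "[x]"]) simp

lemma joined_in_step:
  assumes "joined_in A x y" "adjacent y z" "z \<in> A"
  shows "joined_in A x z"
proof -
  from assms(1) obtain p where
    "p \<noteq> []" "hd p = x" "last p = y" "set p \<subseteq> A" "successively adjacent p"
    unfolding joined_in_def by blast
  with assms show ?thesis
    unfolding joined_in_def
    by (intro exI[of _ "p @ [z]"]) (simp add: successively_append_iff)
qed

text \<open>Replaces path lists by induction along a path that grows at its far end.\<close>

lemma joined_in_induct [consumes 1, case_names refl step]:
  assumes "joined_in A x y"
    and refl: "x \<in> A \<Longrightarrow> P x"
    and step: "\<And>y z. joined_in A x y \<Longrightarrow> P y \<Longrightarrow> adjacent y z \<Longrightarrow> z \<in> A \<Longrightarrow> P z"
  shows "P y"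
proof -
  from assms(1) obtain p where
    "p \<noteq> []" "hd p = x" "last p = y" "set p \<subseteq> A" "successively adjacent p"
    unfolding joined_in_def by blast
  then show ?thesis
  proof (induction p arbitrary: y rule: rev_induct)
    case (snoc z p)
    show ?case
    proof (cases "p = []")
      case True
      with snoc refl show ?thesis by auto
    next
      case False
      with snoc.prems have "joined_in A x (last p)"
        unfolding joined_in_def by (intro exI[of _ p]) (simp add: successively_append_iff)
      moreover have "P (last p)"
        using snoc False by (simp add: successively_append_iff)
      ultimately show ?thesis
        using snoc.prems False step by (simp add: successively_append_iff)
    qed
  qed simp
qed

lemma joined_in_endpoints:
  assumes "joined_in A x y"
  shows "x \<in> A" "y \<in> A"
  using assms unfolding joined_in_def by (metis hd_in_set subsetD, metis last_in_set subsetD)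

lemma joined_in_trans:
  assumes "joined_in A y z" "joined_in A x y"
  shows "joined_in A x z"
  using assms by (induction rule: joined_in_induct) (auto intro: joined_in_step)

lemma joined_in_sym: "joined_in A x y \<Longrightarrow> joined_in A y x"
proof (induction rule: joined_in_induct)
  case (step y z)
  have "joined_in A z y"
    using joined_in_endpoints(2)[OF step.hyps(1)] step.hyps(2,3)
    by (blast intro: joined_in_step joined_in_refl adjacent_sym)
  with step.IH show ?case
    by (rule joined_in_trans)
qed (rule joined_in_refl)

lemma joined_in_mono: "joined_in A x y \<Longrightarrow> A \<subseteq> B \<Longrightarrow> joined_in B x y"
  unfolding joined_in_def by blast

lemma mem_cluster_iff: "y \<in> cluster A x \<longleftrightarrow> joined_in A x y"
  by (simp add: cluster_def)

lemma cluster_subset: "cluster A x \<subseteq> A"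
  using joined_in_endpoints(2) by (force simp: mem_cluster_iff)

lemma cluster_eq: "joined_in A x y \<Longrightarrow> cluster A x = cluster A y"
  unfolding cluster_def by (blast intro: joined_in_trans joined_in_sym)

text \<open>The path has to stay inside the cluster itself, not just inside \<open>A\<close>; it
  does, since each of its vertices is reached from \<open>x\<close>.\<close>

lemma nn_connected_cluster: "nn_connected (cluster A x)"
proof -
  have "joined_in (cluster A x) x y" if "joined_in A x y" for y
    using that
  proof (induction rule: joined_in_induct)
    case refl
    then show ?case
      by (simp add: joined_in_refl mem_cluster_iff)
  next
    case (step y z)
    then show ?case
      by (meson joined_in_step mem_cluster_iff)
  qed
  then show ?thesis
    unfolding nn_connected_def by (meson joined_in_sym joined_in_trans mem_cluster_iff)
qed

text \<open>A discrete intermediate value argument: the sup-norm grows by at most one per step, so a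
  path cannot jump over the sphere of radius \<open>R\<close>.\<close>

lemma joined_in_exits_ball:
  assumes "joined_in V x y" "sup_norm x \<le> int R" "int R \<le> sup_norm y"
  shows "\<exists>z. joined_in (V \<inter> sup_ball 0 R) x z \<and> sup_norm z = int R"
proof -
  let ?W = "V \<inter> sup_ball 0 R"
  \<comment> \<open>Invariant along the path: either it has stayed in the ball so far, or a sphere
    point reachable inside the ball is already recorded.\<close>
  have "joined_in ?W x y \<or> (\<exists>z. joined_in ?W x z \<and> sup_norm z = int R)"
    using assms(1)
  proof (induction rule: joined_in_induct)
    case refl
    then show ?case
      using assms(2) by (simp add: joined_in_refl)
  next
    case (step y z)
    show ?case
    proof (cases "sup_norm z \<le> int R")
      case True
      with step show ?thesis
        by (auto intro: joined_in_step)
    next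
      case False
      \<comment> \<open>The last vertex before leaving has norm exactly \<open>R\<close> and serves
        as the sphere point.\<close>
      then have "sup_norm y \<ge> int R"
        using sup_norm_adjacent[OF step.hyps(2)] by linarith
      with step.IH show ?thesis
        using joined_in_endpoints(2) by fastforce
    qed
  qed
  then show ?thesis
    using joined_in_endpoints(2) assms(3) by fastforce
qed

text \<open>The cluster within the ball contains both \<open>x\<close>, of norm at most
  \<open>k\<close>, and a point of norm \<open>2 * k\<close>. Their distance is at least
  \<open>k\<close>, well above \<open>2 * k / 10\<close>.\<close>

lemma cluster_in_ball_large:
  assumes "x \<in> V" "sup_norm x \<le> int k" "y \<in> cluster V x" "2 * int k \<le> sup_norm y"
  defines "S \<equiv> cluster (V \<inter> sup_ball 0 (2 * k)) x"
  shows "S \<subseteq> V \<inter> sup_ball 0 (2 * k) \<and> nn_connected S \<and> sup_diam S \<ge> ennreal (real (2 * k) / 10)"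
proof -
  obtain z where z: "z \<in> S" "sup_norm z = 2 * int k"
    using joined_in_exits_ball[of V x y "2 * k"] assms by (auto simp: mem_cluster_iff)
  have "x \<in> S"
    using assms by (simp add: mem_cluster_iff joined_in_refl)
  have "int k \<le> sup_norm (z - x)"
    using sup_norm_triangle[of "z - x" x] z(2) assms(2) by simp
  then have "ennreal (real (2 * k) / 10) \<le> ennreal (real_of_int (sup_norm (z - x)))"
    by (intro ennreal_leI) linarith
  also have "\<dots> \<le> sup_diam S"
    using z(1) \<open>x \<in> S\<close> by (rule sup_norm_diff_le_sup_diam)
  finally show ?thesis
    using cluster_subset nn_connected_cluster unfolding S_def by blast
qed

lemma large_sets_connectedD:
  assumes "large_sets_connected n V"
    and "S \<subseteq> V \<inter> sup_ball 0 n \<and> nn_connected S \<and> sup_diam S \<ge> ennreal (real n / 10)"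
    and "T \<subseteq> V \<inter> sup_ball 0 n \<and> nn_connected T \<and> sup_diam T \<ge> ennreal (real n / 10)"
  shows "\<exists>x\<in>S. \<exists>y\<in>T. joined_in (V \<inter> sup_ball 0 (2 * n)) x y"
  using assms(1)[unfolded large_sets_connected_def, rule_format, of S T] assms(2,3) by argo

lemma finite_far_cluster_impossible:
  fixes V :: "(int ^ 'd) set"
  assumes inf: "infinite_cluster_meets_ball k V"
    and conn: "large_sets_connected (2 * k) V"
    and fin: "finite (cluster V 0)"
    and far: "x \<in> cluster V 0" "2 * int k \<le> sup_norm x"
  shows False
proof -
  from inf obtain a w where w: "infinite (cluster V a)" "w \<in> cluster V a" "sup_norm w \<le> int k"
    unfolding infinite_cluster_meets_ball_def clusters_def by auto
  \<comment> \<open>The base point \<open>a\<close> may be far away; the crossing argument has to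
    start from a point of norm at most \<open>k\<close>.\<close>
  then have aw: "cluster V a = cluster V w"
    by (intro cluster_eq) (simp add: mem_cluster_iff)
  obtain y where y: "y \<in> cluster V w" "2 * int k \<le> sup_norm y"
  proof (rule ccontr)
    assume "\<not> thesis"
    with that have "cluster V w \<subseteq> sup_ball 0 (2 * k)"
      by force
    then show False
      using w(1) finite_subset[OF _ finite_sup_ball] unfolding aw by blast
  qed
  have "0 \<in> V" "w \<in> V"
    using far(1) w(2) joined_in_endpoints by (force simp: mem_cluster_iff)+
  let ?W = "V \<inter> sup_ball 0 (2 * k)"
  have "sup_norm (0 :: int ^ 'd) \<le> int k"
    by simp
  note large = cluster_in_ball_large[OF \<open>0 \<in> V\<close> this far]
    cluster_in_ball_large[OF \<open>w \<in> V\<close> w(3) y]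
  from conn have "\<exists>s\<in>cluster ?W 0. \<exists>t\<in>cluster ?W w. joined_in (V \<inter> sup_ball 0 (2 * (2 * k))) s t"
    by (rule large_sets_connectedD) (simp_all only: large)
  then obtain s t where "s \<in> cluster ?W 0" "t \<in> cluster ?W w"
    and "joined_in (V \<inter> sup_ball 0 (2 * (2 * k))) s t"
    by blast
  \<comment> \<open>All three connections are confined to balls; forgetting the balls merges the
    finite cluster of \<open>0\<close> with the infinite one.\<close>
  then have "joined_in V 0 s" "joined_in V w t" "joined_in V s t"
    using joined_in_mono[OF _ Int_lower1] unfolding mem_cluster_iff by blast+
  then have "cluster V 0 = cluster V w"
    using cluster_eq[of V 0 s] cluster_eq[of V s t] cluster_eq[of V w t] by simp
  with fin w(1) aw show False
    by simp
qed

section \<open>Probability bounds\<close>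

text \<open>
  No measurability is needed: a non-measurable set has \<^const>\<open>measure\<close> \<open>0\<close>, and if this happens to
  \<open>A\<close> or \<open>B\<close> then \<open>a \<ge> 1\<close>.
\<close>

lemma (in prob_space) prob_le_of_disjoint_likely:
  assumes A: "1 - a \<le> measure M A" and B: "1 - a \<le> measure M B"
    and disj: "E \<inter> A \<inter> B = {}"
  shows "measure M E \<le> 2 * a"
proof -
  have "0 \<le> a"
    using A prob_le_1[of A] by linarith
  consider "a \<ge> 1" | "E \<notin> sets M" | "a < 1" "E \<in> sets M"
    by linarith
  then show ?thesis
  proof cases
    case 1
    then show ?thesis
      using prob_le_1[of E] by linarith
  next
    case 2
    then show ?thesis
      using \<open>0 \<le> a\<close> by (simp add: measure_notin_sets)
  next
    case 3
    then have AB: "A \<in> sets M" "B \<in> sets M"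
      using A B measure_notin_sets[of A M] measure_notin_sets[of B M] by fastforce+
    have "E \<subseteq> (space M - A) \<union> (space M - B)"
      using disj sets.sets_into_space[OF 3(2)] by blast
    then have "measure M E \<le> measure M ((space M - A) \<union> (space M - B))"
      using AB by (intro finite_measure_mono) auto
    also have "\<dots> \<le> measure M (space M - A) + measure M (space M - B)"
      using AB by (intro measure_Un_le) auto
    also have "\<dots> \<le> 2 * a"
      using A B by (simp add: prob_compl[OF AB(1)] prob_compl[OF AB(2)])
    finally show ?thesis .
  qed
qed

text \<open>Halving the exponent makes room for the factor 8: the product \<open>a * t\<close> is at
  most \<open>t^2\<close> plus a constant, which becomes a prefactor after exponentiation.\<close>

lemma stretched_exp_rescale:
  fixes c :: real
  assumes "1 \<le> k" "1 \<le> n" "n \<le> (8 * k) ^ d" "0 < d" "0 < c"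
  shows "exp (- (real k powr c)) \<le> exp (8 powr c / 4) * exp (- (real n powr (c / (2 * real d))))"
proof -
  define t where "t = real k powr (c / 2)"
  define a where "a = (8 :: real) powr (c / 2)"
  have "real n powr (c / (2 * real d)) \<le> (real (8 * k) ^ d) powr (c / (2 * real d))"
  proof (rule powr_mono2)
    show "real n \<le> real (8 * k) ^ d"
      using assms(3) by (simp only: of_nat_le_iff flip: of_nat_power)
  qed (use assms in auto)
  also have "\<dots> = (real (8 * k) powr real d) powr (c / (2 * real d))"
    using assms by (subst powr_realpow) auto
  also have "\<dots> = real (8 * k) powr (c / 2)"
    using assms by (simp add: powr_powr)
  also have "\<dots> = a * t"
    by (simp add: a_def t_def powr_mult)
  also have "\<dots> \<le> t\<^sup>2 + a\<^sup>2 / 4"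
    using zero_le_power2[of "t - a / 2"] by (simp add: power2_eq_square field_simps)
  also have "t\<^sup>2 = real k powr c"
    by (simp add: t_def power2_eq_square flip: powr_add)
  also have "a\<^sup>2 = 8 powr c"
    by (simp add: a_def power2_eq_square flip: powr_add)
  finally show ?thesis
    by (simp flip: exp_add)
qed

text \<open>The admissible \<open>k\<close> include 0 and are bounded by \<open>n\<close>, so a
  greatest one exists. It may be 0.\<close>

lemma largest_scale:
  fixes d n :: nat
  assumes "0 < d"
  obtains k where "(4 * k) ^ d \<le> n" "n < (4 * (k + 1)) ^ d"
proof -
  let ?P = "\<lambda>k. (4 * k) ^ d \<le> n"
  have bound: "k \<le> n" if "?P k" for k
  proof -
    have "k \<le> (4 * k) ^ d"
      using assms self_le_power[of "4 * k" d] by (cases "k = 0") auto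
    with that show ?thesis by linarith
  qed
  have "?P 0"
    using assms by (simp add: power_0_left)
  then have "?P (Greatest ?P)"
    using bound by (rule GreatestI_nat)
  moreover have "\<not> ?P (Greatest ?P + 1)"
  proof
    assume "?P (Greatest ?P + 1)"
    then have "Greatest ?P + 1 \<le> Greatest ?P"
      using bound by (rule Greatest_le_nat)
    then show False
      by linarith
  qed
  ultimately show thesis
    using that[of "Greatest ?P"] by (simp only: not_le)
qed

lemma far_finite_cluster_prob:
  fixes P :: "(int ^ 'd) set measure"
  assumes "random_interlacements_law u P"
    and "1 - a \<le> measure P {I. infinite_cluster_meets_ball k (vacant_set I)}"
    and "1 - a \<le> measure P {I. large_sets_connected (2 * k) (vacant_set I)}"
    and "\<And>I. I \<in> E \<Longrightarrow> finite (cluster (vacant_set I) 0) \<and>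
           (\<exists>x\<in>cluster (vacant_set I) 0. 2 * int k \<le> sup_norm x)"
  shows "measure P E \<le> 2 * a"
proof -
  interpret prob_space P
    using assms(1) by (simp add: random_interlacements_law_def)
  show ?thesis
    using assms(2,3)
    by (rule prob_le_of_disjoint_likely) (use assms(4) finite_far_cluster_impossible in blast)
qed

theorem corollary1p2:
  fixes Q :: "real \<Rightarrow> (int ^ 'd) set measure"
    and u\<^sub>1 c\<^sub>0 C\<^sub>0 :: real
  assumes dim: "CARD('d) \<ge> 3"
    and interlacements: "\<And>u. 0 \<le> u \<Longrightarrow> random_interlacements_law u (Q u)"
    and u\<^sub>1_pos: "u\<^sub>1 > 0"
    and c\<^sub>0_pos: "c\<^sub>0 > 0"
    and infinite_cluster:
      "\<And>u n. \<lbrakk>0 \<le> u; u \<le> u\<^sub>1; 1 \<le> n\<rbrakk> \<Longrightarrow>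
         measure (Q u) {I. infinite_cluster_meets_ball n (vacant_set I)}
           \<ge> 1 - C\<^sub>0 * exp (- (real n powr c\<^sub>0))"
    and local_uniqueness:
      "\<And>u n. \<lbrakk>0 \<le> u; u \<le> u\<^sub>1; 1 \<le> n\<rbrakk> \<Longrightarrow>
         measure (Q u) {I. large_sets_connected n (vacant_set I)}
           \<ge> 1 - C\<^sub>0 * exp (- (real n powr c\<^sub>0))"
  shows "\<exists>c>0. \<exists>C. \<forall>u n. 0 \<le> u \<longrightarrow> u \<le> u\<^sub>1 \<longrightarrow> 1 \<le> n \<longrightarrow>
      measure (Q u) {I. of_nat n \<le> sup_diam (cluster (vacant_set I) 0) \<and>
                        sup_diam (cluster (vacant_set I) 0) < \<infinity>}
        \<le> C * exp (- (real n powr c)) \<and>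
      measure (Q u) {I. n \<le> card (cluster (vacant_set I) 0) \<and>
                        finite (cluster (vacant_set I) 0)}
        \<le> C * exp (- (real n powr c))"
proof -
  let ?d = "CARD('d)"
  define c where "c = c\<^sub>0 / (2 * real ?d)"
  \<comment> \<open>The first summand pays for two failing events and the rescaling when
    \<open>k\<close> is positive; the second makes the bound at least 1 when \<open>k = 0\<close>,
    that is \<open>n < 4 ^ d\<close>.\<close>
  define C where "C = 2 * \<bar>C\<^sub>0\<bar> * exp (8 powr c\<^sub>0 / 4) + exp (real (4 ^ ?d) powr c)"
  have "0 < ?d"
    using dim by linarith
  then have "c > 0"
    using c\<^sub>0_pos by (simp add: c_def)
  \<comment> \<open>Stated for an arbitrary event \<open>E\<close> so as to cover diameter and
    cardinality at once.\<close>
  have bound: "measure (Q u) E \<le> C * exp (- (real n powr c))"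
    if u: "0 \<le> u" "u \<le> u\<^sub>1" and n: "1 \<le> n"
      and E: "\<And>I k. \<lbrakk>I \<in> E; 1 \<le> k; (4 * k) ^ ?d \<le> n\<rbrakk> \<Longrightarrow>
          finite (cluster (vacant_set I) 0) \<and>
          (\<exists>x\<in>cluster (vacant_set I) 0. 2 * int k \<le> sup_norm x)"
    for u n E
  proof -
    obtain k where k: "(4 * k) ^ ?d \<le> n" "n < (4 * (k + 1)) ^ ?d"
      using largest_scale[OF \<open>0 < ?d\<close>] .
    show ?thesis
    proof (cases "k = 0")
      case True
      interpret prob_space "Q u"
        using interlacements[OF u(1)] by (simp add: random_interlacements_law_def)
      have "real n powr c \<le> real (4 ^ ?d) powr c"
        using k(2) True \<open>c > 0\<close> by (intro powr_mono2) (auto simp flip: of_nat_power)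
      then have "1 \<le> exp (real (4 ^ ?d) powr c) * exp (- (real n powr c))"
        by (simp flip: exp_add)
      also have "\<dots> \<le> C * exp (- (real n powr c))"
        by (intro mult_right_mono) (auto simp: C_def)
      finally show ?thesis
        using prob_le_1[of E] by linarith
    next
      case False
      then have "1 \<le> k" by simp
      let ?a = "\<bar>C\<^sub>0\<bar> * exp (- (real k powr c\<^sub>0))"
      \<comment> \<open>Uniqueness is used at scale \<open>2 * k\<close>; its error is weakened to
        that of scale \<open>k\<close>, giving one common \<open>?a\<close>.\<close>
      have "real k powr c\<^sub>0 \<le> real (2 * k) powr c\<^sub>0"
        using c\<^sub>0_pos by (intro powr_mono2) auto
      then have "C\<^sub>0 * exp (- (real (2 * k) powr c\<^sub>0)) \<le> ?a"
        by (intro mult_mono) auto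
      moreover have "C\<^sub>0 * exp (- (real k powr c\<^sub>0)) \<le> ?a"
        by (intro mult_right_mono) auto
      ultimately have "1 - ?a \<le> measure (Q u) {I. infinite_cluster_meets_ball k (vacant_set I)}"
        and "1 - ?a \<le> measure (Q u) {I. large_sets_connected (2 * k) (vacant_set I)}"
        using infinite_cluster[OF u \<open>1 \<le> k\<close>] local_uniqueness[OF u, of "2 * k"] \<open>1 \<le> k\<close>
        by linarith+
      then have "measure (Q u) E \<le> 2 * ?a"
        by (rule far_finite_cluster_prob[OF interlacements[OF u(1)] _ _ E[OF _ \<open>1 \<le> k\<close> k(1)]])
      also have "\<dots> \<le> 2 * (\<bar>C\<^sub>0\<bar> * (exp (8 powr c\<^sub>0 / 4) * exp (- (real n powr c))))"
      proof -
        \<comment> \<open>Here \<open>k + 1 \<le> 2 * k\<close>, as \<open>k\<close> is at least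
          1.\<close>
        have "(4 * (k + 1)) ^ ?d \<le> (8 * k) ^ ?d"
          using \<open>1 \<le> k\<close> by (intro power_mono) auto
        then have "n \<le> (8 * k) ^ ?d"
          using k(2) by linarith
        from stretched_exp_rescale[OF \<open>1 \<le> k\<close> n this \<open>0 < ?d\<close> c\<^sub>0_pos] show ?thesis
          unfolding c_def by (intro mult_left_mono) auto
      qed
      also have "\<dots> \<le> C * exp (- (real n powr c))"
        by (simp add: C_def algebra_simps)
      finally show ?thesis .
    qed
  qed
  show ?thesis
  proof (rule exI[of _ c], rule conjI[OF \<open>c > 0\<close>], rule exI[of _ C], intro conjI allI impI)
    fix u :: real and n :: nat
    assume u: "0 \<le> u" "u \<le> u\<^sub>1" and n: "1 \<le> n"
    \<comment> \<open>The scale dictated by cardinality also suffices for the diameter.\<close>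
    have le: "4 * k \<le> n" if "1 \<le> k" "(4 * k) ^ ?d \<le> n" for k
      using that self_le_power[of "4 * k" ?d] \<open>0 < ?d\<close> by linarith
    show "measure (Q u) {I. of_nat n \<le> sup_diam (cluster (vacant_set I) 0) \<and>
        sup_diam (cluster (vacant_set I) 0) < \<infinity>} \<le> C * exp (- (real n powr c))"
    proof (rule bound[OF u n], goal_cases)
      case (1 I k)
      then show ?case
        using finite_of_sup_diam_finite[of "cluster (vacant_set I) 0"]
          far_point_of_sup_diam[OF _ le[OF 1(2,3)] 1(2), of "cluster (vacant_set I) 0"] by simp
    qed
    show "measure (Q u) {I. n \<le> card (cluster (vacant_set I) 0) \<and>
        finite (cluster (vacant_set I) 0)} \<le> C * exp (- (real n powr c))"
    proof (rule bound[OF u n], goal_cases)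
      case (1 I k)
      then show ?case
        using far_point_of_card[of n "cluster (vacant_set I) 0" k] by simp
    qed
  qed
qed

end
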